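(* Let $K\ge 2$ be an integer, let $\mathcal{U}=\{a_1,\dots,a_K\}$ be a set of $K$ distinct candidates, let $I$ be a random index in $[K]=\{1,\dots,K\}$, and let $(R_t,C_t)_{t\ge 1}$ be random pairs with $R_t\in\mathcal{U}$ and $C_t$ real-valued. Assume: (1) conditionally on $I$, the pairs $(R_t,C_t)$, $t\ge 1$, are i.i.d.; (2) $I$ is uniform on $\{1,\dots,K\}$; (3) for every $i\in[K]$ and every $t$, $\mathbb{P}(R_t=a_i\mid C_t,I=i)=C_t$ and $\mathbb{P}(R_t=a_j\mid C_t,I=i)=\frac{1-C_t}{K-1}$ for every $j\ne i$; (4) the conditional law of $C_t$ given $I=i$ is the same for all $i\in[K]$. Assume moreover that $C_t\in(0,1)$ almost surely, $\mathbb{P}(C_t=1/K)=0$, and $\mathbb{E}\left[\left|\log\frac{C_t(K-1)}{1-C_t}\right|\right]<\infty$. For $m\ge 1$ and $i\in[K]$ let $$X_i=X_i^{(m)}=\frac{\prod_{t=1}^m \mathbb{P}(R_t\mid C_t,I=i)}{\sum_{k=1}^K\prod_{t=1}^m \mathbb{P}(R_t\mid C_t,I=k)},$$ where $\mathbb{P}(R_t\mid C_t,I=i)$ equals $C_t$ if $R_t=a_i$ and $\frac{1-C_t}{K-1}$ otherwise. Then $$\mathbb{P}\left(\arg\max_{i\in[K]}X_i^{(m)}=I\right)\longrightarrow 1\quad\text{as } m\to\infty.$$ In fact, as $m\to\infty$, almost surely $X_I^{(m)}\to 1$ and $X_k^{(m)}\to 0$ for all $k\ne I$.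
   Context: $R_t$ is the answer returned at the $t$-th sample, $C_t$ is its scalar confidence score, and $I$ is the unknown index of the correct answer (so $a_I$ is the correct answer). $X_i^{(m)}$ is the score of candidate $a_i$ computed from the first $m$ response–confidence pairs. No independence between $R_t$ and $C_t$ is assumed. *)

theory Defs
  imports "HOL-Probability.Probability"
begin

(* The law P( . | I = i).  The index I is discrete and every value is taken with positive
   probability, so conditioning on I amounts to conditioning on each of these events. *)
definition given_index :: "'w measure \<Rightarrow> ('w \<Rightarrow> nat) \<Rightarrow> nat \<Rightarrow> 'w measure" where
  "given_index M I i = uniform_measure M {\<omega> \<in> space M. I \<omega> = i}"

(* A version of the conditional probability N(A | Y), for A an event and Y real-valued;
   it is determined only N-almost everywhere. *)
definition prob_given :: "'w measure \<Rightarrow> ('w \<Rightarrow> real) \<Rightarrow> 'w set \<Rightarrow> 'w \<Rightarrow> real" where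
  "prob_given N Y A = real_cond_exp N (vimage_algebra (space N) Y borel) (indicator A)"

definition likelihood :: "nat \<Rightarrow> (nat \<Rightarrow> 'a) \<Rightarrow> 'a \<Rightarrow> real \<Rightarrow> nat \<Rightarrow> real" where
  "likelihood K a r c i = (if r = a i then c else (1 - c) / (real K - 1))"

(* Where the denominator vanishes (a null event when 0 < C t < 1 almost surely) the score is 0. *)
definition score ::
  "nat \<Rightarrow> (nat \<Rightarrow> 'a) \<Rightarrow> (nat \<Rightarrow> 'w \<Rightarrow> 'a) \<Rightarrow> (nat \<Rightarrow> 'w \<Rightarrow> real) \<Rightarrow> nat \<Rightarrow> nat \<Rightarrow> 'w \<Rightarrow> real" where
  "score K a R C m i \<omega> =
     (\<Prod>t=1..m. likelihood K a (R t \<omega>) (C t \<omega>) i) /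
     (\<Sum>k=1..K. \<Prod>t=1..m. likelihood K a (R t \<omega>) (C t \<omega>) k)"

(* The arg max as the set of all maximisers, so no tie-breaking rule has to be fixed. *)
definition argmax_set :: "('i \<Rightarrow> real) \<Rightarrow> 'i set \<Rightarrow> 'i set" where
  "argmax_set f A = {i. is_arg_max f (\<lambda>i. i \<in> A) i}"

end

theory Submission
  imports Defs
begin

text \<open>Instead of the strong law of large numbers for log-likelihood ratios, the proof uses
  the square roots of the likelihood ratios. Given \<open>I = i\<close>, the variables
  \<open>W\<^sub>t = sqrt (P(R\<^sub>t | C\<^sub>t, I = k) / P(R\<^sub>t | C\<^sub>t, I = i))\<close> are i.i.d.,
  and for \<open>k \<noteq> i\<close> their mean is a Hellinger affinity \<open>r\<close>, which is less than 1 by AM-GM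
  because \<open>C\<^sub>t \<noteq> 1 / K\<close> almost surely. Hence \<open>W\<^sub>1 \<cdots> W\<^sub>m\<close> has mean \<open>r\<^sup>m\<close>; these means
  are summable, so the products tend to 0 almost surely, and so do the likelihood ratios.\<close>

section \<open>Conditional probabilities under the integral\<close>

text \<open>This is the averaging property of conditional expectation. \<open>prob_given\<close> is
  a real conditional expectation, so the work is to identify it with the nonnegative
  \<open>nn_cond_exp\<close>, whose averaging property holds for every nonnegative measurable
  \<open>h\<close>, bounded or not.\<close>

lemma (in prob_space) nn_integral_prob_given:
  fixes Y :: "'a \<Rightarrow> real" and h :: "real \<Rightarrow> ennreal"
  assumes Y: "Y \<in> borel_measurable M" and A: "A \<in> events" and h: "h \<in> borel_measurable borel"
    and p: "AE \<omega> in M. prob_given M Y A \<omega> = p \<omega>"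
  shows "(\<integral>\<^sup>+\<omega>. h (Y \<omega>) * indicator A \<omega> \<partial>M) = (\<integral>\<^sup>+\<omega>. h (Y \<omega>) * ennreal (p \<omega>) \<partial>M)"
proof -
  let ?F = "vimage_algebra (space M) Y borel"
  have "subalgebra M ?F"
    using sets_image_in_sets [OF refl Y] by (simp add: subalgebra_def)
  then interpret finite_measure_subalgebra M ?F
    by unfold_locales
  note A [measurable]
  have hY [measurable]: "(\<lambda>\<omega>. h (Y \<omega>)) \<in> borel_measurable ?F"
    by (rule measurable_compose [OF measurable_vimage_algebra1 h]) simp
  \<comment> \<open>Comparison with the constant 1 excludes the value \<open>top\<close>, which
    \<open>enn2real\<close> would send to 0.\<close>
  have "AE \<omega> in M. nn_cond_exp M ?F (indicator A) \<omega> \<le> nn_cond_exp M ?F (\<lambda>x. 1) \<omega>"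
    by (rule nn_cond_exp_mono) (auto simp: indicator_def)
  moreover have "AE \<omega> in M. 1 = nn_cond_exp M ?F (\<lambda>x. 1) \<omega>"
    by (rule nn_cond_exp_F_meas) simp
  moreover have "AE \<omega> in M. 0 = nn_cond_exp M ?F (\<lambda>x. 0) \<omega>"
    by (rule nn_cond_exp_F_meas) simp
  \<comment> \<open>\<open>real_cond_exp\<close> is the difference of the conditional expectations
    of the positive and negative parts; the negative part of an indicator is 0.\<close>
  moreover have "AE \<omega> in M. enn2real (nn_cond_exp M ?F (indicator A) \<omega>) -
      enn2real (nn_cond_exp M ?F (\<lambda>x. 0) \<omega>) = p \<omega>"
  proof -
    have "(\<lambda>x. ennreal (indicator A x)) = indicator A" "(\<lambda>x. ennreal (- indicator A x)) = (\<lambda>x. 0)"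
      by (auto simp: indicator_def fun_eq_iff ennreal_neg)
    then show ?thesis
      using p by (simp only: prob_given_def real_cond_exp_def)
  qed
  ultimately have "AE \<omega> in M. nn_cond_exp M ?F (indicator A) \<omega> = ennreal (p \<omega>)"
  proof eventually_elim
    case (elim \<omega>)
    then have "nn_cond_exp M ?F (indicator A) \<omega> < top"
      by (metis ennreal_one_less_top order.strict_trans1)
    moreover have "enn2real (nn_cond_exp M ?F (indicator A) \<omega>) = p \<omega>"
      using elim(4) by (simp flip: elim(3))
    ultimately show ?case
      by (metis ennreal_enn2real)
  qed
  then have "(\<integral>\<^sup>+\<omega>. h (Y \<omega>) * ennreal (p \<omega>) \<partial>M) =
      (\<integral>\<^sup>+\<omega>. h (Y \<omega>) * nn_cond_exp M ?F (indicator A) \<omega> \<partial>M)"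
    by (intro nn_integral_cong_AE) auto
  also have "\<dots> = (\<integral>\<^sup>+\<omega>. h (Y \<omega>) * indicator A \<omega> \<partial>M)"
    by (rule nn_cond_exp_intg) simp_all
  finally show ?thesis ..
qed

section \<open>Almost sure limits of products and of normalised weights\<close>

text \<open>By monotone convergence the series of all partial products has expectation 1 / (1 - r).
  It is therefore finite almost surely, and the terms of a convergent series tend to 0.\<close>

lemma (in prob_space) AE_prod_tendsto_0:
  fixes W :: "nat \<Rightarrow> 'a \<Rightarrow> ennreal"
  assumes indep: "indep_vars (\<lambda>_. borel) W {1..}"
    and mean: "\<And>t. t \<ge> 1 \<Longrightarrow> (\<integral>\<^sup>+\<omega>. W t \<omega> \<partial>M) = r" and r: "r < 1"
  shows "AE \<omega> in M. (\<lambda>m. \<Prod>t=1..m. W t \<omega>) \<longlonglongrightarrow> 0"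
proof -
  have [measurable]: "W t \<in> borel_measurable M" if "t \<ge> 1" for t
    using indep that by (auto simp: indep_vars_def)
  have prod_W: "(\<lambda>\<omega>. \<Prod>t=1..m. W t \<omega>) \<in> borel_measurable M" for m
    by (rule borel_measurable_prod_ennreal) auto
  have power: "(\<integral>\<^sup>+\<omega>. (\<Prod>t=1..m. W t \<omega>) \<partial>M) = r ^ m" for m
    using indep_vars_nn_integral [OF _ indep_vars_subset [OF indep], of "{1..m}"] mean by simp
  obtain s where s: "r = ennreal s" "0 \<le> s" "s < 1"
    using r by (cases r) auto
  have "(\<integral>\<^sup>+\<omega>. (\<Sum>m. \<Prod>t=1..m. W t \<omega>) \<partial>M) = (\<Sum>m. r ^ m)"
    by (simp only: nn_integral_suminf [OF prod_W] power)
  also have "\<dots> = ennreal (1 / (1 - s))"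
    using s by (simp add: ennreal_power suminf_ennreal2 suminf_geometric)
  finally have "AE \<omega> in M. (\<Sum>m. \<Prod>t=1..m. W t \<omega>) \<noteq> \<infinity>"
    by (intro nn_integral_noteq_infinite borel_measurable_suminf_order prod_W) simp
  then show ?thesis
  proof eventually_elim
    case (elim \<omega>)
    \<comment> \<open>A finite sum in \<open>ennreal\<close> has finite terms, so the products can
      be read as reals, where summability forces the terms to 0.\<close>
    define f where "f m = enn2real (\<Prod>t=1..m. W t \<omega>)" for m
    have "(\<Prod>t=1..m. W t \<omega>) < top" for m
      using elim ennreal_suminf_lessD [of "\<lambda>m. \<Prod>t=1..m. W t \<omega>" top m] by (simp add: less_top)
    then have f: "(\<Prod>t=1..m. W t \<omega>) = ennreal (f m)" for m
      by (simp add: f_def)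
    have "summable f"
      using elim by (intro summable_suminf_not_top) (simp add: f_def, simp flip: f)
    then have "(\<lambda>m. ennreal (f m)) \<longlonglongrightarrow> ennreal 0"
      by (intro tendsto_ennrealI summable_LIMSEQ_zero)
    then show ?case by (simp flip: f)
  qed
qed

lemma score_limits:
  fixes P :: "'i \<Rightarrow> nat \<Rightarrow> real"
  assumes A: "finite A" "i \<in> A" and nz: "\<And>m. P i m \<noteq> 0"
    and lim: "\<And>k. k \<in> A \<Longrightarrow> k \<noteq> i \<Longrightarrow> (\<lambda>m. P k m / P i m) \<longlonglongrightarrow> 0"
    and k: "k \<in> A"
  shows "(\<lambda>m. P k m / (\<Sum>j\<in>A. P j m)) \<longlonglongrightarrow> (if k = i then 1 else 0)"
proof -
  have ratio: "(\<lambda>m. P j m / P i m) \<longlonglongrightarrow> (if j = i then 1 else 0)" if "j \<in> A" for j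
    using lim [OF that] nz by (cases "j = i") simp_all
  \<comment> \<open>Numerator and denominator are both divided by \<open>P i m\<close>; in the limit
    of the denominator only \<open>j = i\<close> contributes, so that limit is 1.\<close>
  have "(\<lambda>m. (P k m / P i m) / (\<Sum>j\<in>A. P j m / P i m)) \<longlonglongrightarrow>
      (if k = i then 1 else 0) / (\<Sum>j\<in>A. if j = i then 1 else 0)"
    using A k by (intro tendsto_divide tendsto_sum ratio) auto
  then show ?thesis
    using A nz by (simp add: sum_divide_distrib [symmetric])
qed

section \<open>The Hellinger affinity of two response laws\<close>

text \<open>Each of the first two terms equals sqrt (c * q), and c + (K - 1) * q = 1, so the claim
  is the strict AM-GM inequality 2 * sqrt (c * q) < c + q. Equality would need \<open>c = q\<close>,
  that is, the uniform response law with c = 1 / K.\<close>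

lemma affinity_less_1:
  fixes c :: real
  assumes K: "K \<ge> 2" and c: "0 < c" "c < 1" "c \<noteq> 1 / real K"
    and q: "q = (1 - c) / (real K - 1)"
  shows "sqrt (q / c) * c + sqrt (c / q) * q + (real K - 2) * q < 1"
proof -
  have q0: "q > 0" and cq: "c + (real K - 1) * q = 1"
    using K c q by auto
  have "c \<noteq> q"
  proof
    assume "c = q"
    then have "real K * c = 1" using cq by (simp add: algebra_simps)
    then show False using c(3) K by (simp add: field_simps)
  qed
  then have "sqrt c \<noteq> sqrt q" by simp
  then have "0 < (sqrt c - sqrt q)\<^sup>2" by simp
  then have "2 * (sqrt c * sqrt q) < c + q"
    using c q0 by (simp add: power2_eq_square algebra_simps)
  moreover have "sqrt (q / c) * c = sqrt c * sqrt q" "sqrt (c / q) * q = sqrt c * sqrt q"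
    using c q0 by (simp_all add: real_sqrt_divide field_simps)
  ultimately show ?thesis using cq by (simp add: algebra_simps)
qed


lemma measurable_likelihood [measurable]:
  assumes r: "r \<in> measurable N (count_space A)" and c: "c \<in> borel_measurable N"
  shows "(\<lambda>\<omega>. likelihood K a (r \<omega>) (c \<omega>) i) \<in> borel_measurable N"
  using assms unfolding likelihood_def by measurable

lemma likelihood_pos: "K \<ge> 2 \<Longrightarrow> 0 < c \<Longrightarrow> c < 1 \<Longrightarrow> likelihood K a r c i > 0"
  by (simp add: likelihood_def)

text \<open>The expectation is the Hellinger affinity of the two conditional response laws,
  averaged over the confidence.\<close>
lemma (in prob_space) nn_integral_sqrt_likelihood_ratio_less_1:
  fixes R :: "'a \<Rightarrow> 'b" and C :: "'a \<Rightarrow> real"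
  assumes K: "K \<ge> 2" and a: "inj_on a {1..K}"
    and i: "i \<in> {1..K}" and k: "k \<in> {1..K}" "k \<noteq> i"
    and R: "R \<in> measurable M (count_space (a ` {1..K}))"
    and C: "C \<in> borel_measurable M"
    and correct: "AE \<omega> in M. prob_given M C {\<omega> \<in> space M. R \<omega> = a i} \<omega> = C \<omega>"
    and incorrect: "\<And>j. j \<in> {1..K} \<Longrightarrow> j \<noteq> i \<Longrightarrow>
      AE \<omega> in M. prob_given M C {\<omega> \<in> space M. R \<omega> = a j} \<omega> = (1 - C \<omega>) / (real K - 1)"
    and C01: "AE \<omega> in M. 0 < C \<omega> \<and> C \<omega> < 1"
    and CK: "AE \<omega> in M. C \<omega> \<noteq> 1 / real K"
  shows "(\<integral>\<^sup>+\<omega>. ennreal (sqrt (likelihood K a (R \<omega>) (C \<omega>) k / likelihood K a (R \<omega>) (C \<omega>) i)) \<partial>M) < 1"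
proof -
  note R [measurable] C [measurable]
  define q where "q c = (1 - c) / (real K - 1)" for c
  \<comment> \<open>At confidence \<open>c\<close>, \<open>h j c\<close> is the square root of the
    likelihood ratio when the answer is \<open>a j\<close>, and \<open>p j c\<close> is the
    conditional probability of that answer when \<open>i\<close> is the correct index.\<close>
  define h where "h j c = (if j = i then sqrt (q c / c) else if j = k then sqrt (c / q c) else 1)"
    for j c
  define p where "p j c = (if j = i then c else q c)" for j c
  have [measurable]: "h j \<in> borel_measurable borel" "p j \<in> borel_measurable borel"
      "q \<in> borel_measurable borel" for j
    unfolding h_def p_def q_def by measurable
  have ev [measurable]: "{\<omega> \<in> space M. R \<omega> = a j} \<in> events" for j
    by measurable
  let ?W = "\<lambda>\<omega>. ennreal (sqrt (likelihood K a (R \<omega>) (C \<omega>) k / likelihood K a (R \<omega>) (C \<omega>) i))"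
  \<comment> \<open>Exactly one indicator is 1, because the answer is a candidate and
    \<open>a\<close> is injective.\<close>
  have W: "?W \<omega> = (\<Sum>j=1..K. ennreal (h j (C \<omega>)) * indicator {\<omega> \<in> space M. R \<omega> = a j} \<omega>)"
    if \<omega>: "\<omega> \<in> space M" "0 < C \<omega> \<and> C \<omega> < 1" for \<omega>
  proof -
    obtain l where l: "l \<in> {1..K}" "R \<omega> = a l"
      using measurable_space [OF R \<omega>(1)] by auto
    have eq: "R \<omega> = a j \<longleftrightarrow> j = l" if "j \<in> {1..K}" for j
      using l that a by (auto dest: inj_onD)
    have "(\<Sum>j=1..K. ennreal (h j (C \<omega>)) * indicator {\<omega> \<in> space M. R \<omega> = a j} \<omega>)
        = (\<Sum>j=1..K. if j = l then ennreal (h j (C \<omega>)) else 0)"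
      using \<omega> by (intro sum.cong) (auto simp: eq indicator_def)
    also have "\<dots> = ennreal (h l (C \<omega>))"
      using l by simp
    also have "h l (C \<omega>) = sqrt (likelihood K a (R \<omega>) (C \<omega>) k / likelihood K a (R \<omega>) (C \<omega>) i)"
      using eq [OF i] eq [OF k(1)] k(2) \<omega> K
      by (auto simp: h_def likelihood_def q_def)
    finally show ?thesis ..
  qed
  define g where "g c = sqrt (q c / c) * c + sqrt (c / q c) * q c + (real K - 2) * q c" for c
  have [measurable]: "g \<in> borel_measurable borel"
    unfolding g_def by measurable
  \<comment> \<open>The summand is \<open>q c\<close> except at \<open>j = i\<close> and
    \<open>j = k\<close>; splitting off these two corrections makes the sum over \<open>j\<close>
    immediate.\<close>
  have "h j c * p j c = (if j = i then sqrt (q c / c) * c - q c else 0)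
      + (if j = k then sqrt (c / q c) * q c - q c else 0) + q c" for j c
    using k by (auto simp: h_def p_def)
  then have sum_g: "(\<Sum>j=1..K. h j c * p j c) = g c" for c
    using i k by (simp add: sum.distrib g_def algebra_simps)
  \<comment> \<open>The bounds give integrability; the strict pointwise inequality is what makes the
    expectation strictly less than 1 at the end.\<close>
  have bound: "AE \<omega> in M. 0 \<le> g (C \<omega>) \<and> g (C \<omega>) < 1"
    using C01 CK
  proof eventually_elim
    case (elim \<omega>)
    then show ?case
      using affinity_less_1 [OF K _ _ _ q_def, of "C \<omega>"] K by (auto simp: g_def q_def)
  qed
  have int: "integrable M (\<lambda>\<omega>. g (C \<omega>))"
    using bound by (intro integrable_const_bound [where B = 1]) auto
  have "(\<integral>\<^sup>+\<omega>. ?W \<omega> \<partial>M) = (\<integral>\<^sup>+\<omega>. (\<Sum>j=1..K. ennreal (h j (C \<omega>)) * indicator {\<omega> \<in> space M. R \<omega> = a j} \<omega>) \<partial>M)"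
    using C01 W by (intro nn_integral_cong_AE) auto
  also have "\<dots> = (\<Sum>j=1..K. \<integral>\<^sup>+\<omega>. ennreal (h j (C \<omega>)) * indicator {\<omega> \<in> space M. R \<omega> = a j} \<omega> \<partial>M)"
    by (rule nn_integral_sum) measurable
  \<comment> \<open>Conditioning on the confidence replaces each response indicator by its
    conditional probability.\<close>
  also have "\<dots> = (\<Sum>j=1..K. \<integral>\<^sup>+\<omega>. ennreal (h j (C \<omega>)) * ennreal (p j (C \<omega>)) \<partial>M)"
    using correct incorrect
    by (intro sum.cong refl nn_integral_prob_given [where h = "\<lambda>c. ennreal (h _ c)"])
       (auto simp: p_def q_def)
  also have "\<dots> = (\<integral>\<^sup>+\<omega>. (\<Sum>j=1..K. ennreal (h j (C \<omega>)) * ennreal (p j (C \<omega>))) \<partial>M)"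
    by (rule nn_integral_sum [symmetric]) measurable
  also have "\<dots> = (\<integral>\<^sup>+\<omega>. ennreal (\<Sum>j=1..K. h j (C \<omega>) * p j (C \<omega>)) \<partial>M)"
    using C01 K
    by (intro nn_integral_cong_AE) (auto simp: h_def p_def q_def ennreal_mult simp flip: sum_ennreal)
  also have "\<dots> = (\<integral>\<^sup>+\<omega>. ennreal (g (C \<omega>)) \<partial>M)"
    by (simp only: sum_g)
  also have "\<dots> = ennreal (expectation (\<lambda>\<omega>. g (C \<omega>)))"
    using bound int by (intro nn_integral_eq_integral) auto
  also have "\<dots> < 1"
    using expectation_less [OF int, of 1] bound by (simp add: ennreal_less_one_iff)
  finally show ?thesis .
qed

text \<open>Here \<open>M\<close> plays the role of the conditional law given \<open>I = i\<close>.
  The square roots are one fixed function \<open>w\<close> of the i.i.d. pairs, so they are i.i.d.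
  themselves, with mean below 1 by the affinity bound at the first sample.\<close>

lemma (in prob_space) AE_likelihood_ratio_tendsto_0:
  fixes R :: "nat \<Rightarrow> 'a \<Rightarrow> 'b" and C :: "nat \<Rightarrow> 'a \<Rightarrow> real"
  defines "S K a \<equiv> count_space (a ` {1..K}) \<Otimes>\<^sub>M (borel :: real measure)"
  assumes K: "K \<ge> 2" and a: "inj_on a {1..K}"
    and i: "i \<in> {1..K}" and k: "k \<in> {1..K}" "k \<noteq> i"
    and R: "\<And>t. t \<ge> 1 \<Longrightarrow> R t \<in> measurable M (count_space (a ` {1..K}))"
    and C: "\<And>t. t \<ge> 1 \<Longrightarrow> C t \<in> borel_measurable M"
    and indep: "indep_vars (\<lambda>_. S K a) (\<lambda>t \<omega>. (R t \<omega>, C t \<omega>)) {1..}"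
    and ident: "\<And>t. t \<ge> 1 \<Longrightarrow>
      distr M (S K a) (\<lambda>\<omega>. (R t \<omega>, C t \<omega>)) = distr M (S K a) (\<lambda>\<omega>. (R 1 \<omega>, C 1 \<omega>))"
    and correct: "AE \<omega> in M. prob_given M (C 1) {\<omega> \<in> space M. R 1 \<omega> = a i} \<omega> = C 1 \<omega>"
    and incorrect: "\<And>j. j \<in> {1..K} \<Longrightarrow> j \<noteq> i \<Longrightarrow>
      AE \<omega> in M. prob_given M (C 1) {\<omega> \<in> space M. R 1 \<omega> = a j} \<omega> = (1 - C 1 \<omega>) / (real K - 1)"
    and C01: "\<And>t. t \<ge> 1 \<Longrightarrow> AE \<omega> in M. 0 < C t \<omega> \<and> C t \<omega> < 1"
    and CK: "AE \<omega> in M. C 1 \<omega> \<noteq> 1 / real K"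
  shows "AE \<omega> in M. (\<lambda>m. (\<Prod>t=1..m. likelihood K a (R t \<omega>) (C t \<omega>) k) /
      (\<Prod>t=1..m. likelihood K a (R t \<omega>) (C t \<omega>) i)) \<longlonglongrightarrow> 0"
proof -
  define w where
    "w x = sqrt (likelihood K a (fst x) (snd x) k / likelihood K a (fst x) (snd x) i)" for x
  define W where "W t \<omega> = ennreal (w (R t \<omega>, C t \<omega>))" for t \<omega>
  have w [measurable]: "w \<in> borel_measurable (S K a)"
    unfolding w_def S_def by measurable
  have RC: "(\<lambda>\<omega>. (R t \<omega>, C t \<omega>)) \<in> measurable M (S K a)" if "t \<ge> 1" for t
    unfolding S_def using R [OF that] C [OF that] by measurable
  have indep_W: "indep_vars (\<lambda>_. borel) W {1..}"
    unfolding W_def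
    by (rule indep_vars_compose2 [OF indep, where Y = "\<lambda>_ x. ennreal (w x)"]) measurable
  have int_W: "(\<integral>\<^sup>+\<omega>. W t \<omega> \<partial>M) = (\<integral>\<^sup>+x. ennreal (w x) \<partial>distr M (S K a) (\<lambda>\<omega>. (R t \<omega>, C t \<omega>)))"
    if "t \<ge> 1" for t
    unfolding W_def by (rule nn_integral_distr [OF RC [OF that], symmetric]) measurable
  have mean: "(\<integral>\<^sup>+\<omega>. W t \<omega> \<partial>M) = (\<integral>\<^sup>+\<omega>. W 1 \<omega> \<partial>M)" if "t \<ge> 1" for t
    unfolding int_W [OF that] int_W [OF order_refl] ident [OF that] ..
  have "(\<integral>\<^sup>+\<omega>. W 1 \<omega> \<partial>M) < 1"
    unfolding W_def w_def fst_conv snd_conv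
    using nn_integral_sqrt_likelihood_ratio_less_1 [OF K a i k R C correct incorrect C01 CK] by simp
  then have "AE \<omega> in M. (\<lambda>m. \<Prod>t=1..m. W t \<omega>) \<longlonglongrightarrow> 0"
    by (intro AE_prod_tendsto_0 [OF indep_W mean])
  \<comment> \<open>Countably many null sets are merged, so that one \<omega> serves all
    samples.\<close>
  moreover have "AE \<omega> in M. \<forall>t\<in>{1..}. 0 < C t \<omega> \<and> C t \<omega> < 1"
    using C01 by (subst AE_ball_countable) auto
  ultimately show ?thesis
  proof eventually_elim
    case (elim \<omega>)
    have pos: "likelihood K a (R t \<omega>) (C t \<omega>) j > 0" if "t \<ge> 1" for t j
      using elim(2) that K by (intro likelihood_pos) auto
    have "(\<Prod>t=1..m. W t \<omega>) = ennreal (\<Prod>t=1..m. w (R t \<omega>, C t \<omega>))" for m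
      unfolding W_def w_def using pos by (intro prod_ennreal) (simp add: less_imp_le)
    moreover have "(\<Prod>t=1..m. w (R t \<omega>, C t \<omega>)) \<ge> 0" for m
      unfolding w_def using pos by (intro prod_nonneg) (simp add: less_imp_le)
    ultimately have "(\<lambda>m. \<Prod>t=1..m. w (R t \<omega>, C t \<omega>)) \<longlonglongrightarrow> 0"
      using elim(1) tendsto_ennreal_iff [of _ sequentially 0] by simp
    \<comment> \<open>Squaring undoes the square roots and recovers the likelihood ratio.\<close>
    then have "(\<lambda>m. (\<Prod>t=1..m. w (R t \<omega>, C t \<omega>))\<^sup>2) \<longlonglongrightarrow> 0\<^sup>2"
      by (rule tendsto_power)
    moreover have "(\<Prod>t=1..m. w (R t \<omega>, C t \<omega>))\<^sup>2 = (\<Prod>t=1..m. likelihood K a (R t \<omega>) (C t \<omega>) k) /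
      (\<Prod>t=1..m. likelihood K a (R t \<omega>) (C t \<omega>) i)" for m
      unfolding prod_power_distrib prod_dividef [symmetric]
      by (intro prod.cong) (simp_all add: w_def pos less_imp_le)
    ultimately show ?case by (simp only: zero_power2)
  qed
qed

section \<open>Unique maximisers and convergence of probabilities\<close>

text \<open>Strict comparisons of scores are easy to handle both for measurability and for limits,
  unlike an equation between sets.\<close>

lemma argmax_set_eq_singleton_iff:
  fixes f :: "'i \<Rightarrow> real"
  assumes i: "i \<in> A"
  shows "argmax_set f A = {i} \<longleftrightarrow> (\<forall>k\<in>A. k \<noteq> i \<longrightarrow> f k < f i)"
proof
  assume "argmax_set f A = {i}"
  then have iff: "is_arg_max f (\<lambda>i. i \<in> A) k \<longleftrightarrow> k = i" for k
    by (auto simp: argmax_set_def)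
  then have "\<not> f i < f k" if "k \<in> A" for k
    using that by (auto simp: is_arg_max_def)
  moreover have "f k \<noteq> f i" if "k \<in> A" "k \<noteq> i" for k
    using iff [of i] iff [of k] that by (auto simp: is_arg_max_def)
  ultimately show "\<forall>k\<in>A. k \<noteq> i \<longrightarrow> f k < f i"
    by (meson linorder_neqE_linordered_idom)
next
  assume "\<forall>k\<in>A. k \<noteq> i \<longrightarrow> f k < f i"
  then show "argmax_set f A = {i}"
    using i by (fastforce simp: argmax_set_def is_arg_max_def)
qed

text \<open>The indicators of the events converge to 1 almost surely and are dominated by 1, so
  dominated convergence applies.\<close>

lemma (in prob_space) prob_tendsto_1:
  assumes P: "\<And>m. {\<omega> \<in> space M. P m \<omega>} \<in> events"
    and ev: "AE \<omega> in M. eventually (\<lambda>m. P m \<omega>) sequentially"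
  shows "(\<lambda>m. prob {\<omega> \<in> space M. P m \<omega>}) \<longlonglongrightarrow> 1"
proof -
  note P [measurable]
  have "(\<lambda>m. expectation (indicator {\<omega> \<in> space M. P m \<omega>})) \<longlonglongrightarrow> expectation (\<lambda>_. 1 :: real)"
  proof (rule integral_dominated_convergence [where w = "\<lambda>_. 1"])
    show "AE \<omega> in M. (\<lambda>m. indicator {\<omega> \<in> space M. P m \<omega>} \<omega> :: real) \<longlonglongrightarrow> 1"
      using ev AE_space
      by eventually_elim (auto intro!: tendsto_eventually elim: eventually_mono)
  qed (auto simp: indicator_def)
  then show ?thesis by (simp add: prob_space)
qed

section \<open>Consistency: from the conditional laws to the random index\<close>

theorem theorem3p2:
  fixes M :: "'w measure"
    and K :: nat
    and a :: "nat \<Rightarrow> 'a"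
    and I :: "'w \<Rightarrow> nat"
    and R :: "nat \<Rightarrow> 'w \<Rightarrow> 'a"
    and C :: "nat \<Rightarrow> 'w \<Rightarrow> real"
  assumes "prob_space M"
    and "K \<ge> 2"
    and "inj_on a {1..K}"
    and "I \<in> measurable M (count_space {1..K})"
    and "\<And>t. t \<ge> 1 \<Longrightarrow> R t \<in> measurable M (count_space (a ` {1..K}))"
    and "\<And>t. t \<ge> 1 \<Longrightarrow> C t \<in> borel_measurable M"
    and cond_indep: "\<And>i. i \<in> {1..K} \<Longrightarrow>
          prob_space.indep_vars (given_index M I i)
            (\<lambda>_. count_space (a ` {1..K}) \<Otimes>\<^sub>M borel) (\<lambda>t \<omega>. (R t \<omega>, C t \<omega>)) {1..}"
    and cond_ident: "\<And>i s t. i \<in> {1..K} \<Longrightarrow> s \<ge> 1 \<Longrightarrow> t \<ge> 1 \<Longrightarrow>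
          distr (given_index M I i) (count_space (a ` {1..K}) \<Otimes>\<^sub>M borel) (\<lambda>\<omega>. (R s \<omega>, C s \<omega>)) =
          distr (given_index M I i) (count_space (a ` {1..K}) \<Otimes>\<^sub>M borel) (\<lambda>\<omega>. (R t \<omega>, C t \<omega>))"
    and uniform: "\<And>i. i \<in> {1..K} \<Longrightarrow> measure M {\<omega> \<in> space M. I \<omega> = i} = 1 / real K"
    and correct: "\<And>i t. i \<in> {1..K} \<Longrightarrow> t \<ge> 1 \<Longrightarrow>
          AE \<omega> in given_index M I i.
            prob_given (given_index M I i) (C t) {\<omega> \<in> space M. R t \<omega> = a i} \<omega> = C t \<omega>"
    and incorrect: "\<And>i j t. i \<in> {1..K} \<Longrightarrow> j \<in> {1..K} \<Longrightarrow> j \<noteq> i \<Longrightarrow> t \<ge> 1 \<Longrightarrow>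
          AE \<omega> in given_index M I i.
            prob_given (given_index M I i) (C t) {\<omega> \<in> space M. R t \<omega> = a j} \<omega>
              = (1 - C t \<omega>) / (real K - 1)"
    and same_law: "\<And>i j t. i \<in> {1..K} \<Longrightarrow> j \<in> {1..K} \<Longrightarrow> t \<ge> 1 \<Longrightarrow>
          distr (given_index M I i) borel (C t) = distr (given_index M I j) borel (C t)"
    and "\<And>t. t \<ge> 1 \<Longrightarrow> AE \<omega> in M. 0 < C t \<omega> \<and> C t \<omega> < 1"
    and "\<And>t. t \<ge> 1 \<Longrightarrow> measure M {\<omega> \<in> space M. C t \<omega> = 1 / real K} = 0"
    and "\<And>t. t \<ge> 1 \<Longrightarrow>
          integrable M (\<lambda>\<omega>. \<bar>ln (C t \<omega> * (real K - 1) / (1 - C t \<omega>))\<bar>)"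
  shows "(\<lambda>m. measure M {\<omega> \<in> space M.
             argmax_set (\<lambda>i. score K a R C m i \<omega>) {1..K} = {I \<omega>}}) \<longlonglongrightarrow> 1
       \<and> (AE \<omega> in M.
             (\<lambda>m. score K a R C m (I \<omega>) \<omega>) \<longlonglongrightarrow> 1 \<and>
             (\<forall>k\<in>{1..K}. k \<noteq> I \<omega> \<longrightarrow> (\<lambda>m. score K a R C m k \<omega>) \<longlonglongrightarrow> 0))"
proof -
  interpret prob_space M by fact
  note K = \<open>K \<ge> 2\<close> and a = \<open>inj_on a {1..K}\<close>
  note I [measurable] = \<open>I \<in> measurable M (count_space {1..K})\<close>
  note R [measurable] = \<open>\<And>t. t \<ge> 1 \<Longrightarrow> R t \<in> measurable M (count_space (a ` {1..K}))\<close>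
  note C [measurable] = \<open>\<And>t. t \<ge> 1 \<Longrightarrow> C t \<in> borel_measurable M\<close>
  note C01 = \<open>\<And>t. t \<ge> 1 \<Longrightarrow> AE \<omega> in M. 0 < C t \<omega> \<and> C t \<omega> < 1\<close>
  have I_range: "I \<omega> \<in> {1..K}" if "\<omega> \<in> space M" for \<omega>
    using measurable_space [OF I that] by simp
  have "AE \<omega> in M. \<omega> \<notin> {\<omega> \<in> space M. C 1 \<omega> = 1 / real K}"
    using \<open>\<And>t. t \<ge> 1 \<Longrightarrow> measure M {\<omega> \<in> space M. C t \<omega> = 1 / real K} = 0\<close> [of 1]
    by (intro AE_not_in) (simp add: null_sets_def emeasure_eq_measure)
  then have CK: "AE \<omega> in M. C 1 \<omega> \<noteq> 1 / real K"
    using AE_space by eventually_elim simp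
  define L where "L j m \<omega> = (\<Prod>t=1..m. likelihood K a (R t \<omega>) (C t \<omega>) j)" for j m \<omega>
  have score_L: "score K a R C m j \<omega> = L j m \<omega> / (\<Sum>k=1..K. L k m \<omega>)" for j m \<omega>
    by (simp add: score_def L_def)
  have [measurable]: "L j m \<in> borel_measurable M" for j m
    unfolding L_def
    by (intro borel_measurable_prod measurable_likelihood [where A = "a ` {1..K}"] R C) auto
  have [measurable]: "score K a R C m j \<in> borel_measurable M" for j m
    unfolding score_L by measurable
  have ratio: "AE \<omega> in M. I \<omega> = i \<longrightarrow> (\<lambda>m. L k m \<omega> / L i m \<omega>) \<longlonglongrightarrow> 0"
    if i: "i \<in> {1..K}" and k: "k \<in> {1..K}" "k \<noteq> i" for i k
  proof -
    let ?A = "{\<omega> \<in> space M. I \<omega> = i}" and ?N = "given_index M I i"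
    \<comment> \<open>Uniformity gives the conditioning event probability 1 / K > 0, so
      \<open>?N\<close> is a probability measure and its almost sure statements are those of
      \<open>M\<close> restricted to \<open>?A\<close>.\<close>
    have A: "emeasure M ?A \<noteq> 0" "emeasure M ?A < \<infinity>"
      using uniform [OF i] K by (simp_all add: emeasure_eq_measure)
    interpret N: prob_space ?N
      unfolding given_index_def using A by (intro prob_space_uniform_measure) auto
    have AE_N: "AE \<omega> in ?N. P \<omega>" if "AE \<omega> in M. P \<omega>" for P
      unfolding given_index_def using that by (subst AE_uniform_measure [OF A]) auto
    have meas: "measurable ?N = measurable M"
      by (simp add: fun_eq_iff measurable_def given_index_def)
    have space: "space ?N = space M" by (simp add: given_index_def)
    have "AE \<omega> in ?N. (\<lambda>m. L k m \<omega> / L i m \<omega>) \<longlonglongrightarrow> 0"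
      unfolding L_def
    proof (rule N.AE_likelihood_ratio_tendsto_0 [OF K a i k _ _ cond_indep [OF i]])
      show "R t \<in> measurable ?N (count_space (a ` {1..K}))" if "t \<ge> 1" for t
        unfolding meas using that by (rule R)
      show "C t \<in> borel_measurable ?N" if "t \<ge> 1" for t
        unfolding meas using that by (rule C)
      show "AE \<omega> in ?N. prob_given ?N (C 1) {\<omega> \<in> space ?N. R 1 \<omega> = a i} \<omega> = C 1 \<omega>"
        unfolding space using i by (rule correct) simp
      show "AE \<omega> in ?N. prob_given ?N (C 1) {\<omega> \<in> space ?N. R 1 \<omega> = a j} \<omega> = (1 - C 1 \<omega>) / (real K - 1)"
        if "j \<in> {1..K}" "j \<noteq> i" for j
        unfolding space using i that by (rule incorrect) simp
      show "AE \<omega> in ?N. 0 < C t \<omega> \<and> C t \<omega> < 1" if "t \<ge> 1" for t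
        using C01 [OF that] by (rule AE_N)
      show "AE \<omega> in ?N. C 1 \<omega> \<noteq> 1 / real K"
        using CK by (rule AE_N)
    qed (rule cond_ident [OF i], simp_all)
    then have "AE \<omega> in M. \<omega> \<in> ?A \<longrightarrow> (\<lambda>m. L k m \<omega> / L i m \<omega>) \<longlonglongrightarrow> 0"
      unfolding given_index_def by (subst (asm) AE_uniform_measure [OF A])
    then show ?thesis
      using AE_space by eventually_elim simp
  qed
  \<comment> \<open>Only finitely many pairs occur, so a single null set suffices and
    \<open>i\<close> may then be taken to be the random \<open>I \<omega>\<close>.\<close>
  then have "AE \<omega> in M. \<forall>i\<in>{1..K}. \<forall>k\<in>{1..K}.
      k \<noteq> i \<longrightarrow> I \<omega> = i \<longrightarrow> (\<lambda>m. L k m \<omega> / L i m \<omega>) \<longlonglongrightarrow> 0"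
    by (intro AE_finite_allI) auto
  moreover have "AE \<omega> in M. \<forall>t\<in>{1..}. 0 < C t \<omega> \<and> C t \<omega> < 1"
    using C01 by (subst AE_ball_countable) auto
  ultimately have lim: "AE \<omega> in M. \<forall>k\<in>{1..K}.
      (\<lambda>m. score K a R C m k \<omega>) \<longlonglongrightarrow> (if k = I \<omega> then 1 else 0)"
    using AE_space
  proof eventually_elim
    case (elim \<omega>)
    have "likelihood K a (R t \<omega>) (C t \<omega>) j > 0" if "t \<ge> 1" for t j
      using elim(2) that K by (intro likelihood_pos) auto
    then have "L (I \<omega>) m \<omega> > 0" for m
      unfolding L_def by (intro prod_pos) simp
    then have "L (I \<omega>) m \<omega> \<noteq> 0" for m
      by (simp add: less_imp_neq [symmetric])
    then show ?case
      unfolding score_L using elim(1) I_range [OF elim(3)]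
      by (intro ballI score_limits [where P = "\<lambda>k m. L k m \<omega>"]) auto
  qed
  have "(\<lambda>m. prob {\<omega> \<in> space M. argmax_set (\<lambda>i. score K a R C m i \<omega>) {1..K} = {I \<omega>}}) \<longlonglongrightarrow> 1"
  proof (rule prob_tendsto_1)
    fix m
    \<comment> \<open>Splitting over the finitely many values of \<open>I\<close> removes the random
      index from the scores, leaving finite combinations of measurable conditions.\<close>
    have "{\<omega> \<in> space M. argmax_set (\<lambda>i. score K a R C m i \<omega>) {1..K} = {I \<omega>}} =
        {\<omega> \<in> space M. \<exists>i\<in>{1..K}. I \<omega> = i \<and>
          (\<forall>k\<in>{1..K}. k \<noteq> i \<longrightarrow> score K a R C m k \<omega> < score K a R C m i \<omega>)}"
      using argmax_set_eq_singleton_iff [OF I_range] I_range by blast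
    also have "\<dots> \<in> events" by measurable
    finally show "{\<omega> \<in> space M. argmax_set (\<lambda>i. score K a R C m i \<omega>) {1..K} = {I \<omega>}} \<in> events" .
  next
    show "AE \<omega> in M. \<forall>\<^sub>F m in sequentially.
        argmax_set (\<lambda>i. score K a R C m i \<omega>) {1..K} = {I \<omega>}"
      using lim AE_space
    proof eventually_elim
      case (elim \<omega>)
      note I\<omega> = I_range [OF elim(2)]
      have "\<forall>\<^sub>F m in sequentially. k \<noteq> I \<omega> \<longrightarrow>
          score K a R C m k \<omega> < score K a R C m (I \<omega>) \<omega>" if k: "k \<in> {1..K}" for k
      proof (cases "k = I \<omega>")
        case False
        then have lims: "(\<lambda>m. score K a R C m k \<omega>) \<longlonglongrightarrow> 0"
          "(\<lambda>m. score K a R C m (I \<omega>) \<omega>) \<longlonglongrightarrow> 1"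
          using elim(1) k I\<omega> by force+
        \<comment> \<open>The threshold 1/2 separates the limits 0 and 1; any number strictly
          between them would do.\<close>
        have "\<forall>\<^sub>F m in sequentially. score K a R C m k \<omega> < 1/2"
          using lims(1) by (rule order_tendstoD) simp
        moreover have "\<forall>\<^sub>F m in sequentially. 1/2 < score K a R C m (I \<omega>) \<omega>"
          using lims(2) by (rule order_tendstoD) simp
        ultimately show ?thesis by eventually_elim simp
      qed simp
      then show ?case
        using I\<omega> by (simp add: argmax_set_eq_singleton_iff eventually_ball_finite)
    qed
  qed
  moreover have "AE \<omega> in M. (\<lambda>m. score K a R C m (I \<omega>) \<omega>) \<longlonglongrightarrow> 1 \<and>
      (\<forall>k\<in>{1..K}. k \<noteq> I \<omega> \<longrightarrow> (\<lambda>m. score K a R C m k \<omega>) \<longlonglongrightarrow> 0)"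
    using lim AE_space by eventually_elim (use I_range in force)
  ultimately show ?thesis ..
qed

end
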